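(* Let $I\subseteq\mathbb{R}$ be an open interval, let $k^2: I\to\mathbb{R}$ be continuous, and let $\varphi,\Delta,\chi: I\to\mathbb{C}$ be arbitrary (real or complex valued) functions with $\varphi\in C^2$, $\Delta,\chi\in C^1$ and $\varphi'(x)\neq 0$ for all $x\in I$; fix a $C^1$ branch of $\sqrt{\varphi'}$. Define $$\rho_1=\varphi''+2\chi\varphi',\qquad \rho_2=k^2+\chi^2+\chi'-(\varphi')^2 .$$ For functions $a,b:I\to\mathbb{C}$ consider the first-order linear system $$\frac{d}{dx}\begin{pmatrix}a\\ b\end{pmatrix}=\frac{1}{2\varphi'}\begin{pmatrix} i[\rho_2-2\varphi'\Delta'] & (\rho_1+i\rho_2)\,e^{-2i\varphi-2i\Delta}\\ (\rho_1-i\rho_2)\,e^{+2i\varphi+2i\Delta} & -i[\rho_2-2\varphi'\Delta']\end{pmatrix}\begin{pmatrix}a\\ b\end{pmatrix},\qquad (\ast)$$ and the function $$\psi(x)=a(x)\,\frac{e^{i\varphi+i\Delta}}{\sqrt{\varphi'}}+b(x)\,\frac{e^{-i\varphi-i\Delta}}{\sqrt{\varphi'}} .\qquad (\ast\ast)$$ If $(a,b)$ solves $(\ast)$, then $\psi$ defined by $(\ast\ast)$ satisfies the gauge condition $$\frac{d}{dx}\left(\frac{a\,e^{i\Delta}}{\sqrt{\varphi'}}\right)e^{i\varphi}+\frac{d}{dx}\left(\frac{b\,e^{-i\Delta}}{\sqrt{\varphi'}}\right)e^{-i\varphi}=\chi\,\psi$$ and the Schr\"odinger equation $\psi''+k^2\psi=0$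 on $I$. Conversely, every solution $\psi$ of $\psi''+k^2\psi=0$ on $I$ is of the form $(\ast\ast)$ with $(a,b)$ solving $(\ast)$. Consequently, for any $x_0\in I$, the general solution of $\psi''+k^2\psi=0$ is $$\psi(x)=\frac{1}{\sqrt{\varphi'(x)}}\begin{pmatrix}e^{i\varphi(x)+i\Delta(x)} & e^{-i\varphi(x)-i\Delta(x)}\end{pmatrix}E(x,x_0)\begin{pmatrix}a(x_0)\\ b(x_0)\end{pmatrix},$$ where $E(x,x_0)$ is the path-ordered exponential of the matrix appearing in $(\ast)$.
   Context: If $M(x)$ denotes the $2\times 2$ coefficient matrix of the first-order system $(\ast)$ (including the prefactor $1/(2\varphi')$), the path-ordered exponential $E(x,x_0)=\mathcal{P}\exp\left(\int_{x_0}^x M(\bar x)\,d\bar x\right)$ is the unique matrix solution of $\partial_xE(x,x_0)=M(x)E(x,x_0)$ with $E(x_0,x_0)=I$. Primes denote $d/dx$. In the physical application $k^2(x)=2m[E-V(x)]/\hbar^2$. *)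

theory Defs
  imports "HOL-Analysis.Analysis"
begin

abbreviation vderiv :: "(real \<Rightarrow> 'a::real_normed_vector) \<Rightarrow> real \<Rightarrow> 'a"
  where "vderiv f \<equiv> (\<lambda>x. vector_derivative f (at x))"

(* All regularity notions below use the two-sided derivative "at x"; they are meant for open sets. *)

definition C2_differentiable_on :: "(real \<Rightarrow> 'a::real_normed_vector) \<Rightarrow> real set \<Rightarrow> bool"
    (infix \<open>C2'_differentiable'_on\<close> 50)
  where "f C2_differentiable_on S \<longleftrightarrow> f C1_differentiable_on S \<and> vderiv f C1_differentiable_on S"

(* The function called k2 is the paper's k^2 as a whole; it may take negative values. *)

definition schrodinger_solution :: "real set \<Rightarrow> (real \<Rightarrow> real) \<Rightarrow> (real \<Rightarrow> complex) \<Rightarrow> bool"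
  where "schrodinger_solution I k2 \<psi> \<longleftrightarrow>
    (\<forall>x\<in>I. \<psi> differentiable (at x) \<and> vderiv \<psi> differentiable (at x) \<and>
      vderiv (vderiv \<psi>) x + of_real (k2 x) * \<psi> x = 0)"

definition linear_system_solution :: "real set \<Rightarrow> (real \<Rightarrow> complex^2^2) \<Rightarrow> (real \<Rightarrow> complex^2) \<Rightarrow> bool"
  where "linear_system_solution I M y \<longleftrightarrow>
    (\<forall>x\<in>I. (y has_vector_derivative (M x *v y x)) (at x))"

definition fundamental_solution ::
    "real set \<Rightarrow> (real \<Rightarrow> complex^2^2) \<Rightarrow> real \<Rightarrow> (real \<Rightarrow> complex^2^2) \<Rightarrow> bool"
  where "fundamental_solution I M x0 F \<longleftrightarrow>
    (\<forall>x\<in>I. (F has_vector_derivative (M x ** F x)) (at x)) \<and> F x0 = mat 1"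

(* The defining problem determines F only on I, so the value at x rather than the function is
   chosen by THE. *)
definition path_ordered_exp ::
    "real set \<Rightarrow> (real \<Rightarrow> complex^2^2) \<Rightarrow> real \<Rightarrow> real \<Rightarrow> complex^2^2"
  where "path_ordered_exp I M x x0 = (THE A. \<exists>F. fundamental_solution I M x0 F \<and> F x = A)"

definition rho1 :: "(real \<Rightarrow> complex) \<Rightarrow> (real \<Rightarrow> complex) \<Rightarrow> real \<Rightarrow> complex"
  where "rho1 \<phi> chi x = vderiv (vderiv \<phi>) x + 2 * chi x * vderiv \<phi> x"

definition rho2 ::
    "(real \<Rightarrow> real) \<Rightarrow> (real \<Rightarrow> complex) \<Rightarrow> (real \<Rightarrow> complex) \<Rightarrow> real \<Rightarrow> complex"
  where "rho2 k2 \<phi> chi x = of_real (k2 x) + (chi x)^2 + vderiv chi x - (vderiv \<phi> x)^2"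

definition system_matrix :: "(real \<Rightarrow> real) \<Rightarrow> (real \<Rightarrow> complex) \<Rightarrow> (real \<Rightarrow> complex) \<Rightarrow>
    (real \<Rightarrow> complex) \<Rightarrow> real \<Rightarrow> complex^2^2"
  where "system_matrix k2 \<phi> \<Delta> chi x =
    (let c = 1 / (2 * vderiv \<phi> x);
         r1 = rho1 \<phi> chi x;
         r2 = rho2 k2 \<phi> chi x;
         d = \<i> * (r2 - 2 * vderiv \<phi> x * vderiv \<Delta> x)
     in vector
       [vector [c * d, c * ((r1 + \<i> * r2) * exp (- 2 * \<i> * \<phi> x - 2 * \<i> * \<Delta> x))],
        vector [c * ((r1 - \<i> * r2) * exp (2 * \<i> * \<phi> x + 2 * \<i> * \<Delta> x)), c * (- d)]])"

(* In the next two definitions s is the chosen branch of the square root of the derivative of phi. *)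

definition psi_of :: "(real \<Rightarrow> complex) \<Rightarrow> (real \<Rightarrow> complex) \<Rightarrow> (real \<Rightarrow> complex) \<Rightarrow>
    (real \<Rightarrow> complex) \<Rightarrow> (real \<Rightarrow> complex) \<Rightarrow> real \<Rightarrow> complex"
  where "psi_of s \<phi> \<Delta> a b x =
    a x * (exp (\<i> * \<phi> x + \<i> * \<Delta> x) / s x) + b x * (exp (- \<i> * \<phi> x - \<i> * \<Delta> x) / s x)"

definition gauge_condition :: "real set \<Rightarrow> (real \<Rightarrow> complex) \<Rightarrow> (real \<Rightarrow> complex) \<Rightarrow>
    (real \<Rightarrow> complex) \<Rightarrow> (real \<Rightarrow> complex) \<Rightarrow> (real \<Rightarrow> complex) \<Rightarrow> (real \<Rightarrow> complex) \<Rightarrow> bool"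
  where "gauge_condition I s \<phi> \<Delta> chi a b \<longleftrightarrow>
    (\<forall>x\<in>I. (\<lambda>t. a t * exp (\<i> * \<Delta> t) / s t) differentiable (at x) \<and>
      (\<lambda>t. b t * exp (- \<i> * \<Delta> t) / s t) differentiable (at x) \<and>
      vderiv (\<lambda>t. a t * exp (\<i> * \<Delta> t) / s t) x * exp (\<i> * \<phi> x)
        + vderiv (\<lambda>t. b t * exp (- \<i> * \<Delta> t) / s t) x * exp (- \<i> * \<phi> x)
      = chi x * psi_of s \<phi> \<Delta> a b x)"

definition wave_row :: "(real \<Rightarrow> complex) \<Rightarrow> (real \<Rightarrow> complex) \<Rightarrow> real \<Rightarrow> complex^2"
  where "wave_row \<phi> \<Delta> x =
    vector [exp (\<i> * \<phi> x + \<i> * \<Delta> x), exp (- \<i> * \<phi> x - \<i> * \<Delta> x)]"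

end

theory Submission
  imports Defs
begin

text \<open>In the amplitudes \<open>p = a e\<^sup>i\<^sup>\<theta> / s\<close> and \<open>q = b e\<^sup>-\<^sup>i\<^sup>\<theta> / s\<close> with \<open>\<theta> = \<phi> + \<Delta>\<close>, the linear
  system is equivalent to a pair of equations whose sum says
  \<open>\<psi>' = \<chi> \<psi> + i \<phi>' (p - q)\<close> for \<open>\<psi> = p + q\<close> (the gauge condition), and whose difference then
  says \<open>\<psi>'' = - k\<^sup>2 \<psi>\<close>. Conversely \<open>\<psi>\<close> and \<open>\<psi>'\<close> determine \<open>p + q\<close> and \<open>p - q\<close>, hence
  \<open>a\<close> and \<open>b\<close>. The path-ordered exponential exists as a Peano--Baker series; the bound
  \<open>B (K |x - x0|)\<^sup>n / n!\<close> on Picard iterates gives both its convergence and, applied to the constant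
  sequence of iterates of a solution vanishing at \<open>x0\<close>, uniqueness.\<close>

section \<open>Linear differential equations on an open interval\<close>

text \<open>Integrating the bound of order \<open>n\<close> along the segment gains the factor
  \<open>K * \<bar>x - x0\<bar> / (n + 1)\<close>. \<open>Y\<close> may be the terms of the
  Peano-Baker series or the constant sequence of a single solution that vanishes at
  \<open>x0\<close>.\<close>

lemma picard_iterate_bound:
  fixes Y Y' :: "nat \<Rightarrow> real \<Rightarrow> 'b::real_normed_vector"
  assumes deriv: "\<And>n t. t \<in> closed_segment x0 x \<Longrightarrow>
      (Y (Suc n) has_vector_derivative Y' n t) (at t)"
    and bound: "\<And>n t. t \<in> closed_segment x0 x \<Longrightarrow> norm (Y' n t) \<le> K * norm (Y n t)"
    and init: "\<And>n. Y (Suc n) x0 = 0"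
    and start: "\<And>t. t \<in> closed_segment x0 x \<Longrightarrow> norm (Y 0 t) \<le> B"
    and "K \<ge> 0"
  shows "norm (Y n x) \<le> B * (K * \<bar>x - x0\<bar>) ^ n / fact n"
proof -
  \<comment> \<open>The segment is parametrised from \<open>x0\<close> by \<open>t\<close> in
    \<open>{0..1}\<close>, so that \<open>x < x0\<close> and \<open>x > x0\<close> are one
    case.\<close>
  define h where "h = x - x0"
  define H where "H = K * \<bar>h\<bar>"
  have seg: "x0 + t * h \<in> closed_segment x0 x" if "t \<in> {0..1}" for t
    using that by (auto simp: closed_segment_def h_def algebra_simps intro!: exI[of _ t])
  have "norm (Y n (x0 + t * h)) \<le> B * (H * t) ^ n / fact n" if "t \<in> {0..1}" for t
    using that
  proof (induction n arbitrary: t)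
    case 0
    then show ?case using start seg by simp
  next
    case (Suc n)
    \<comment> \<open>\<open>f\<close> is the next iterate along the segment; \<open>g\<close> is
      its claimed bound, whose derivative is \<open>\<bar>h\<bar> * K\<close> times the bound of
      order \<open>n\<close>.\<close>
    define f where "f = (\<lambda>r. Y (Suc n) (x0 + r * h))"
    define g where "g = (\<lambda>r. B * (H * r) ^ Suc n / fact (Suc n))"
    have f': "(f has_vector_derivative h *\<^sub>R Y' n (x0 + r * h)) (at r)" if "r \<in> {0..1}" for r
    proof -
      have "((\<lambda>r. x0 + r * h) has_vector_derivative h) (at r)"
        by (auto intro!: derivative_eq_intros simp: has_real_derivative_iff_has_vector_derivative[symmetric])
      from vector_diff_chain_at[OF this deriv[OF seg[OF that]]]
      show ?thesis by (simp add: f_def o_def)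
    qed
    have g': "(g has_vector_derivative \<bar>h\<bar> * (K * (B * (H * r) ^ n / fact n))) (at r)" for r
    proof -
      have "((\<lambda>r. (H * r) ^ Suc n) has_real_derivative real (Suc n) * (H * (H * r) ^ n)) (at r)"
        using DERIV_power[OF DERIV_cmult_Id[of H r UNIV], of "Suc n"]
        by (simp only: diff_Suc_Suc diff_zero)
      then have "(g has_real_derivative B * (real (Suc n) * (H * (H * r) ^ n)) / fact (Suc n)) (at r)"
        unfolding g_def by (rule DERIV_cdivide[OF DERIV_cmult])
      also have "B * (real (Suc n) * (H * (H * r) ^ n)) / fact (Suc n) =
          B * ((H * r) ^ n * H) * real (Suc n) / (real (Suc n) * fact n)"
        by (simp only: fact_Suc of_nat_mult of_nat_fact mult_ac)
      also have "\<dots> = B * ((H * r) ^ n * H) / fact n"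
        by (simp del: of_nat_Suc)
      also have "\<dots> = \<bar>h\<bar> * (K * (B * (H * r) ^ n / fact n))"
        by (simp add: H_def mult_ac)
      finally show ?thesis by (simp add: has_real_derivative_iff_has_vector_derivative)
    qed
    \<comment> \<open>The mean value inequality wants a proper interval \<open>{0..t}\<close>; at
      \<open>t = 0\<close> both sides vanish.\<close>
    show ?case
    proof (cases "t = 0")
      case True
      then show ?thesis using init by simp
    next
      case False
      with Suc.prems have t: "0 < t" "t \<le> 1" by auto
      have "norm (f t - f 0) \<le> g t - g 0"
      proof (rule differentiable_bound_general[OF t(1)])
        show "continuous_on {0..t} f"
          using t by (intro continuous_at_imp_continuous_on ballI
              has_vector_derivative_continuous[OF f']) auto
        show "continuous_on {0..t} g"
          by (intro continuous_at_imp_continuous_on ballI has_vector_derivative_continuous[OF g'])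
        show "(f has_vector_derivative h *\<^sub>R Y' n (x0 + r * h)) (at r)" if "0 < r" "r < t" for r
          using that t by (intro f') auto
        show "(g has_vector_derivative \<bar>h\<bar> * (K * (B * (H * r) ^ n / fact n))) (at r)" for r
          by (rule g')
        fix r assume "0 < r" "r < t"
        then have r: "r \<in> {0..1}" using t by auto
        have "norm (Y' n (x0 + r * h)) \<le> K * (B * (H * r) ^ n / fact n)"
          by (rule order_trans[OF bound[OF seg[OF r]] mult_left_mono[OF Suc.IH[OF r] \<open>K \<ge> 0\<close>]])
        then show "norm (h *\<^sub>R Y' n (x0 + r * h)) \<le> \<bar>h\<bar> * (K * (B * (H * r) ^ n / fact n))"
          unfolding norm_scaleR by (rule mult_left_mono) simp
      qed
      then show ?thesis by (simp add: f_def g_def init)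
    qed
  qed
  from this[of 1] show ?thesis by (simp add: H_def h_def)
qed

lemma exp_majorant_tendsto_0: "(\<lambda>n. B * (r::real) ^ n / fact n) \<longlonglongrightarrow> 0"
  and exp_majorant_summable: "summable (\<lambda>n. B * (r::real) ^ n / fact n)"
proof -
  show *: "summable (\<lambda>n. B * (r::real) ^ n / fact n)"
    using summable_mult[OF summable_exp[of r], of B] by (simp add: field_simps)
  show "(\<lambda>n. B * (r::real) ^ n / fact n) \<longlonglongrightarrow> 0"
    by (rule summable_LIMSEQ_zero[OF *])
qed

text \<open>The compact window reaches \<open>x0\<close> and has \<open>x\<close> in its interior:
  continuous functions are bounded and integrable on it, while a derivative within it at
  \<open>x\<close> is two-sided.\<close>

lemma open_interval_window:
  fixes I :: "real set"
  assumes "open I" "is_interval I" "x0 \<in> I" "x \<in> I"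
  obtains c d where "x \<in> {c<..<d}" "x0 \<in> {c..d}" "{c..d} \<subseteq> I"
proof -
  obtain e where e: "e > 0" "cball x e \<subseteq> I"
    using assms(1,4) open_contains_cball by blast
  have "x - e \<in> I" "x + e \<in> I" using e by (auto simp: dist_real_def subset_iff)
  then have "min (x - e) x0 \<in> I" "max (x + e) x0 \<in> I"
    using \<open>x0 \<in> I\<close> by (auto simp: min_def max_def)
  then have "{min (x - e) x0..max (x + e) x0} \<subseteq> I"
    using \<open>is_interval I\<close> unfolding is_interval_1 subset_iff atLeastAtMost_iff by blast
  then show thesis using \<open>e > 0\<close> by (intro that[of "min (x - e) x0" "max (x + e) x0"]) auto
qed

lemma open_interval_antiderivative:
  fixes g :: "real \<Rightarrow> 'b::banach"
  assumes "open I" "is_interval I" "x0 \<in> I" "continuous_on I g"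
  shows "\<exists>G. G x0 = 0 \<and> (\<forall>x\<in>I. (G has_vector_derivative g x) (at x))"
proof -
  \<comment> \<open>The integral over \<open>{u..v}\<close> is 0 when \<open>v < u\<close>, so
    \<open>G x\<close> is the oriented integral from \<open>x0\<close> to \<open>x\<close>.\<close>
  define G where "G x = integral {x0..x} g - integral {x..x0} g" for x
  have "(G has_vector_derivative g x) (at x)" if "x \<in> I" for x
  proof -
    obtain c d where x: "x \<in> {c<..<d}" and x0: "x0 \<in> {c..d}" and sub: "{c..d} \<subseteq> I"
      using open_interval_window[OF \<open>open I\<close> \<open>is_interval I\<close> \<open>x0 \<in> I\<close> \<open>x \<in> I\<close>] .
    have cont: "continuous_on {c..d} g" using assms(4) sub continuous_on_subset by blast
    have int: "g integrable_on {u..v}" if "c \<le> u" "v \<le> d" for u v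
      using that cont by (intro integrable_continuous_real) (auto elim: continuous_on_subset)
    \<comment> \<open>The fundamental theorem is applied with base point \<open>c\<close>;
      subtracting the constant \<open>integral {c..x0} g\<close> then moves the base point to
      \<open>x0\<close>.\<close>
    have "((\<lambda>u. integral {c..u} g) has_vector_derivative g x) (at x within {c..d})"
      using x by (intro integral_has_vector_derivative[OF cont]) auto
    then have "((\<lambda>u. integral {c..u} g) has_vector_derivative g x) (at x)"
      using x by (simp add: at_within_Icc_at)
    then have "((\<lambda>u. integral {c..u} g - integral {c..x0} g) has_vector_derivative g x) (at x)"
      using has_vector_derivative_diff_const by fastforce
    then show ?thesis
    proof (rule has_vector_derivative_transform_within_open[OF _ open_greaterThanLessThan x])
      fix y assume y: "y \<in> {c<..<d}"
      show "integral {c..y} g - integral {c..x0} g = G y"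
      proof (cases "x0 \<le> y")
        case True
        have "integral {c..x0} g + integral {x0..y} g = integral {c..y} g"
          using y True x0 by (intro Henstock_Kurzweil_Integration.integral_combine int) auto
        moreover have "integral {y..x0} g = 0" using True by (cases "x0 = y") auto
        ultimately show ?thesis by (simp add: G_def algebra_simps)
      next
        case False
        have "integral {c..y} g + integral {y..x0} g = integral {c..x0} g"
          using y False x0 by (intro Henstock_Kurzweil_Integration.integral_combine int) auto
        moreover have "integral {x0..y} g = 0" using False by auto
        ultimately show ?thesis by (simp add: G_def algebra_simps)
      qed
    qed
  qed
  then show ?thesis by (intro exI[of _ G]) (simp add: G_def)
qed

section \<open>Uniqueness and existence for linear equations\<close>

lemma continuous_on_compact_bilinear_bound:
  fixes bil :: "'a::real_normed_vector \<Rightarrow> 'b::real_normed_vector \<Rightarrow> 'b"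
  assumes "bounded_bilinear bil" "compact S" "continuous_on S A"
  shows "\<exists>K\<ge>0. \<forall>t\<in>S. \<forall>v. norm (bil (A t) v) \<le> K * norm v"
proof -
  obtain C where C: "C > 0" "\<And>t. t \<in> S \<Longrightarrow> norm (A t) \<le> C"
    using compact_imp_bounded[OF compact_continuous_image[OF assms(3,2)]]
    unfolding bounded_pos by auto
  obtain P where P: "P \<ge> 0" "\<And>a b. norm (bil a b) \<le> norm a * norm b * P"
    using bounded_bilinear.nonneg_bounded[OF assms(1)] by blast
  show ?thesis
  \<comment> \<open>\<open>C\<close> bounds the coefficient on \<open>S\<close> and \<open>P\<close>
    the bilinear map. Keeping \<open>bil\<close> abstract lets the results serve vector and matrix
    equations alike.\<close>
  proof (intro exI[of _ "C * P"] conjI ballI allI)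
    show "C * P \<ge> 0" using C P by simp
    fix t v assume "t \<in> S"
    have "norm (bil (A t) v) \<le> norm (A t) * norm v * P" by (rule P)
    also have "\<dots> \<le> C * norm v * P"
      using C(2)[OF \<open>t \<in> S\<close>] P(1) by (intro mult_right_mono) auto
    finally show "norm (bil (A t) v) \<le> C * P * norm v" by (simp add: mult_ac)
  qed
qed

lemma linear_ode_unique_zero:
  fixes bil :: "'a::real_normed_vector \<Rightarrow> 'b::real_normed_vector \<Rightarrow> 'b"
  assumes "bounded_bilinear bil" "is_interval I" "continuous_on I A" "x0 \<in> I"
    and ode: "\<And>x. x \<in> I \<Longrightarrow> (y has_vector_derivative bil (A x) (y x)) (at x)"
    and "y x0 = 0" "x \<in> I"
  shows "y x = 0"
proof -
  let ?S = "closed_segment x0 x"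
  have sub: "?S \<subseteq> I"
    using assms(2,4,7) by (simp add: closed_segment_subset is_interval_convex)
  obtain K where K: "K \<ge> 0" "\<And>t v. t \<in> ?S \<Longrightarrow> norm (bil (A t) v) \<le> K * norm v"
    using continuous_on_compact_bilinear_bound[OF assms(1) compact_segment
        continuous_on_subset[OF assms(3) sub]] by auto
  have cont: "continuous_on ?S y"
    using sub by (intro continuous_at_imp_continuous_on ballI
        has_vector_derivative_continuous[OF ode]) auto
  then obtain B where B: "\<And>t. t \<in> ?S \<Longrightarrow> norm (y t) \<le> B"
    using compact_imp_bounded[OF compact_continuous_image[OF cont compact_segment]]
    unfolding bounded_iff by blast
  \<comment> \<open>A solution vanishing at \<open>x0\<close> counts as its own next iterate: the
    left-hand side is the same for every \<open>n\<close>, while the bound tends to 0.\<close>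
  have "norm (y x) \<le> B * (K * \<bar>x - x0\<bar>) ^ n / fact n" for n
    using picard_iterate_bound[where Y = "\<lambda>_. y" and Y' = "\<lambda>_ t. bil (A t) (y t)"
        and ?x0.0 = x0 and x = x and K = K and B = B] sub ode K B \<open>y x0 = 0\<close> by blast
  then have "norm (y x) \<le> 0"
    by (intro LIMSEQ_le_const[OF exp_majorant_tendsto_0]) blast
  then show ?thesis by simp
qed

lemma linear_ode_unique:
  fixes bil :: "'a::real_normed_vector \<Rightarrow> 'b::real_normed_vector \<Rightarrow> 'b"
  assumes "bounded_bilinear bil" "is_interval I" "continuous_on I A" "x0 \<in> I"
    and "\<And>x. x \<in> I \<Longrightarrow> (y has_vector_derivative bil (A x) (y x)) (at x)"
    and "\<And>x. x \<in> I \<Longrightarrow> (z has_vector_derivative bil (A x) (z x)) (at x)"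
    and "y x0 = z x0" "x \<in> I"
  shows "y x = z x"
proof -
  have "y x - z x = 0"
  proof (rule linear_ode_unique_zero[OF assms(1-4), where y = "\<lambda>t. y t - z t"])
    show "((\<lambda>t. y t - z t) has_vector_derivative bil (A t) (y t - z t)) (at t)" if "t \<in> I" for t
      using that assms(5,6)
      by (auto intro: has_vector_derivative_diff simp: bounded_bilinear.diff_right[OF assms(1)])
  qed (use assms in auto)
  then show ?thesis by simp
qed

text \<open>The solution is a series starting with \<open>y0\<close>, each further term being the
  integral from \<open>x0\<close> of the coefficient times the preceding term. The exponential bound
  holds on every compact window, so the series converges on all of \<open>I\<close> and not only
  near \<open>x0\<close>.\<close>

lemma linear_ode_exists:
  fixes bil :: "'a::real_normed_vector \<Rightarrow> 'b::banach \<Rightarrow> 'b"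
  assumes bil: "bounded_bilinear bil" and "open I" "is_interval I"
    and A: "continuous_on I A" and "x0 \<in> I"
  shows "\<exists>y. y x0 = y0 \<and> (\<forall>x\<in>I. (y has_vector_derivative bil (A x) (y x)) (at x))"
proof -
  \<comment> \<open>\<open>J g\<close> is an antiderivative vanishing at \<open>x0\<close>. This is
    guaranteed for continuous \<open>g\<close>, so continuity of every \<open>Y n\<close> has to be
    shown first.\<close>
  define J :: "(real \<Rightarrow> 'b) \<Rightarrow> real \<Rightarrow> 'b" where
    "J g = (SOME G. G x0 = 0 \<and> (\<forall>x\<in>I. (G has_vector_derivative g x) (at x)))" for g
  have J: "J g x0 = 0 \<and> (\<forall>x\<in>I. (J g has_vector_derivative g x) (at x))"
    if "continuous_on I g" for g
    unfolding J_def
    by (rule someI_ex[OF open_interval_antiderivative[OF assms(2,3,5) that]])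
  define Y where "Y = rec_nat (\<lambda>_. y0) (\<lambda>_ Z. J (\<lambda>x. bil (A x) (Z x)))"
  have Y_0: "Y 0 = (\<lambda>_. y0)" and Y_Suc: "Y (Suc n) = J (\<lambda>x. bil (A x) (Y n x))" for n
    by (simp_all add: Y_def)
  have cont: "continuous_on I (Y n)" for n
  proof (induction n)
    case (Suc n)
    then have "continuous_on I (\<lambda>x. bil (A x) (Y n x))"
      by (intro bounded_bilinear.continuous_on[OF bil] A)
    from J[OF this] show ?case unfolding Y_Suc
      by (intro continuous_at_imp_continuous_on ballI)
        (auto intro: has_vector_derivative_continuous)
  qed (simp add: Y_0)
  have "continuous_on I (\<lambda>x. bil (A x) (Y n x))" for n
    by (intro bounded_bilinear.continuous_on[OF bil] A cont)
  from J[OF this]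
  have init: "Y (Suc n) x0 = 0"
    and deriv: "x \<in> I \<Longrightarrow> (Y (Suc n) has_vector_derivative bil (A x) (Y n x)) (at x)" for n x
    by (simp_all add: Y_Suc)
  define y where "y x = (\<Sum>n. Y n x)" for x
  have "y x0 = y0"
  proof -
    \<comment> \<open>All integrals vanish at \<open>x0\<close>; only the term of index 0
      survives.\<close>
    have "y x0 = (\<Sum>n\<in>{0}. Y n x0)"
      unfolding y_def using init by (intro suminf_finite) (auto simp: gr0_conv_Suc)
    then show ?thesis by (simp add: Y_0)
  qed
  moreover have "(y has_vector_derivative bil (A x) (y x)) (at x)" if "x \<in> I" for x
  proof -
    obtain c d where x: "x \<in> {c<..<d}" and x0: "x0 \<in> {c..d}" and sub: "{c..d} \<subseteq> I"
      using open_interval_window[OF \<open>open I\<close> \<open>is_interval I\<close> \<open>x0 \<in> I\<close> \<open>x \<in> I\<close>] .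
    obtain K where K: "K \<ge> 0" "\<And>t v. t \<in> {c..d} \<Longrightarrow> norm (bil (A t) v) \<le> K * norm v"
      using continuous_on_compact_bilinear_bound[OF bil compact_Icc
          continuous_on_subset[OF A sub]] by auto
    \<comment> \<open>On the window \<open>\<bar>t - x0\<bar> \<le> d - c\<close>, which makes the
      bound uniform in \<open>t\<close>.\<close>
    define M where "M n = norm y0 * (K * (d - c)) ^ n / fact n" for n
    have bound: "norm (Y n t) \<le> M n" if t: "t \<in> {c..d}" for n t
    proof -
      have seg: "closed_segment x0 t \<subseteq> {c..d}"
        using x0 t by (auto simp: closed_segment_eq_real_ivl split: if_splits)
      have "norm (Y n t) \<le> norm y0 * (K * \<bar>t - x0\<bar>) ^ n / fact n"
        using seg sub K
        by (intro picard_iterate_bound[where Y' = "\<lambda>n t. bil (A t) (Y n t)"])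
          (auto simp: Y_0 init intro!: deriv)
      also have "\<dots> \<le> M n"
        unfolding M_def using x0 t K(1)
        by (intro divide_right_mono mult_left_mono power_mono mult_nonneg_nonneg) auto
      finally show ?thesis .
    qed
    have M: "summable M" unfolding M_def by (rule exp_majorant_summable)
    \<comment> \<open>The derivatives of the terms: 0 for the constant \<open>Y 0\<close>, otherwise
      the coefficient applied to the preceding term. By this index shift they sum to
      \<open>bil (A t) (y t)\<close>.\<close>
    define Y' where "Y' n t = (case n of 0 \<Rightarrow> 0 | Suc m \<Rightarrow> bil (A t) (Y m t))" for n t
    have Y': "(Y n has_vector_derivative Y' n t) (at t within {c..d})" if "t \<in> {c..d}" for n t
      using that sub
      by (cases n) (auto simp: Y'_def Y_0 intro!: has_vector_derivative_at_within[OF deriv])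
    have Y_summable: "summable (\<lambda>n. Y n t)" if "t \<in> {c..d}" for t
      using bound[OF that] by (intro summable_comparison_test'[OF M]) auto
    have Y'_sums: "(\<lambda>n. Y' n t) sums bil (A t) (y t)" if "t \<in> {c..d}" for t
    proof -
      have "(\<lambda>n. bil (A t) (Y n t)) sums bil (A t) (y t)"
        unfolding y_def
        by (intro bounded_linear.sums[OF bounded_bilinear.bounded_linear_right[OF bil]]
            summable_sums Y_summable that)
      then have "(\<lambda>n. Y' (Suc n) t) sums bil (A t) (y t)" by (simp add: Y'_def)
      then show ?thesis using sums_Suc_iff[of "\<lambda>n. Y' n t"] by (simp add: Y'_def)
    qed
    \<comment> \<open>Uniform convergence of the derivatives, with majorants \<open>K * M m\<close>,
      permits termwise differentiation.\<close>
    have "uniform_limit {c..d} (\<lambda>n t. \<Sum>i<n. Y' i t) (\<lambda>t. \<Sum>i. Y' i t) sequentially"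
    proof (rule Weierstrass_m_test[where M = "\<lambda>n. case n of 0 \<Rightarrow> 0 | Suc m \<Rightarrow> K * M m"])
      show "norm (Y' n t) \<le> (case n of 0 \<Rightarrow> 0 | Suc m \<Rightarrow> K * M m)" if "t \<in> {c..d}" for n t
        using order_trans[OF K(2)[OF that] mult_left_mono[OF bound[OF that] K(1)]]
        by (auto simp: Y'_def split: nat.split)
      show "summable (\<lambda>n. case n of 0 \<Rightarrow> 0 | Suc m \<Rightarrow> K * M m)"
        by (subst summable_Suc_iff[symmetric]) (simp add: summable_mult M)
    qed
    then have lim: "uniform_limit {c..d} (\<lambda>n t. \<Sum>i<n. Y' i t) (\<lambda>t. bil (A t) (y t)) sequentially"
      by (rule uniform_limit_cong'[THEN iffD1, rotated 2])
        (simp_all add: sums_unique[OF Y'_sums, symmetric])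
    have "\<exists>g. \<forall>t\<in>{c..d}. (\<lambda>n. Y n t) sums g t \<and>
        (g has_derivative (\<lambda>h. h *\<^sub>R bil (A t) (y t))) (at t within {c..d})"
    proof (rule has_derivative_series[where f' = "\<lambda>n t h. h *\<^sub>R Y' n t"])
      show "(Y n has_derivative (\<lambda>h. h *\<^sub>R Y' n t)) (at t within {c..d})" if "t \<in> {c..d}" for n t
        using Y'[OF that] by (simp add: has_vector_derivative_def)
      show "\<forall>\<^sub>F n in sequentially. \<forall>t\<in>{c..d}. \<forall>h.
          norm ((\<Sum>i<n. h *\<^sub>R Y' i t) - h *\<^sub>R bil (A t) (y t)) \<le> r * norm h" if "r > 0" for r
        using uniform_limitD[OF lim that]
      proof (rule eventually_mono, intro ballI allI)
        fix n t h
        assume *: "\<forall>t\<in>{c..d}. dist (\<Sum>i<n. Y' i t) (bil (A t) (y t)) < r" and t: "t \<in> {c..d}"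
        have "norm ((\<Sum>i<n. h *\<^sub>R Y' i t) - h *\<^sub>R bil (A t) (y t)) =
            \<bar>h\<bar> * dist (\<Sum>i<n. Y' i t) (bil (A t) (y t))"
          by (simp add: scaleR_sum_right[symmetric] scaleR_diff_right[symmetric] dist_norm)
        also have "\<dots> \<le> \<bar>h\<bar> * r" using * t by (intro mult_left_mono) (auto intro: less_imp_le)
        finally show "norm ((\<Sum>i<n. h *\<^sub>R Y' i t) - h *\<^sub>R bil (A t) (y t)) \<le> r * norm h"
          by (simp add: mult_ac)
      qed
      show "(\<lambda>n. Y n x0) sums y x0" unfolding y_def by (intro summable_sums Y_summable x0)
    qed (use x0 in auto)
    \<comment> \<open>\<open>g\<close> is the sum of the series and hence agrees with
      \<open>y\<close> on the window.\<close>
    then obtain g where g: "\<And>t. t \<in> {c..d} \<Longrightarrow> (\<lambda>n. Y n t) sums g t"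
      "\<And>t. t \<in> {c..d} \<Longrightarrow> (g has_vector_derivative bil (A t) (y t)) (at t within {c..d})"
      unfolding has_vector_derivative_def by metis
    have "(g has_vector_derivative bil (A x) (y x)) (at x)"
      using g(2)[of x] x by (simp add: at_within_Icc_at)
    then show ?thesis
      by (rule has_vector_derivative_transform_within_open[OF _ open_greaterThanLessThan x])
        (simp add: y_def sums_unique[OF g(1), symmetric])
  qed
  ultimately show ?thesis by blast
qed

section \<open>Bilinear matrix products and componentwise calculus\<close>

lemma bounded_bilinear_matrix_matrix_mult:
  "bounded_bilinear ((**) :: complex^'n^'m \<Rightarrow> complex^'k^'n \<Rightarrow> complex^'k^'m)"
  \<comment> \<open>In finite dimension bilinear maps are bounded, so only real bilinearity is to be
    checked.\<close>
  unfolding bilinear_conv_bounded_bilinear[symmetric] bilinear_def linear_iff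
  by (simp add: matrix_matrix_mult_def vec_eq_iff algebra_simps sum.distrib scaleR_sum_right)

lemma bounded_bilinear_matrix_vector_mult:
  "bounded_bilinear ((*v) :: complex^'n^'m \<Rightarrow> complex^'n \<Rightarrow> complex^'m)"
  unfolding bilinear_conv_bounded_bilinear[symmetric] bilinear_def linear_iff
  by (simp add: matrix_vector_mult_def vec_eq_iff algebra_simps sum.distrib scaleR_sum_right)

lemma has_vector_derivative_vector_2:
  fixes a b :: "real \<Rightarrow> 'a::euclidean_space"
  shows "((\<lambda>x. vector [a x, b x] :: 'a^2) has_vector_derivative v) (at x) \<longleftrightarrow>
    (a has_vector_derivative v $ 1) (at x) \<and> (b has_vector_derivative v $ 2) (at x)"
proof
  assume *: "((\<lambda>x. vector [a x, b x] :: 'a^2) has_vector_derivative v) (at x)"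
  show "(a has_vector_derivative v $ 1) (at x) \<and> (b has_vector_derivative v $ 2) (at x)"
    using bounded_linear.has_vector_derivative[OF bounded_linear_vec_nth *, of 1]
      bounded_linear.has_vector_derivative[OF bounded_linear_vec_nth *, of 2] by simp
next
  assume *: "(a has_vector_derivative v $ 1) (at x) \<and> (b has_vector_derivative v $ 2) (at x)"
  \<comment> \<open>The two coordinates are put together through the axis embeddings, which are
    bounded linear.\<close>
  have "bounded_linear (axis i :: 'a \<Rightarrow> 'a^2)" for i
    unfolding linear_conv_bounded_linear[symmetric] linear_iff
    by (simp add: axis_def vec_eq_iff)
  note ax = bounded_linear.has_vector_derivative[OF this]
  have "((\<lambda>x. axis 1 (a x) + axis 2 (b x) :: 'a^2) has_vector_derivative
      axis 1 (v $ 1) + axis 2 (v $ 2)) (at x)"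
    using * by (intro has_vector_derivative_add ax) auto
  moreover have "axis 1 (p $ 1) + axis 2 (p $ 2) = p" for p :: "'a^2"
    by (simp add: vec_eq_iff forall_2 axis_def)
  from this[of "vector [_, _]"] this[of v]
  have "axis 1 r + axis 2 t = (vector [r, t] :: 'a^2)" "axis 1 (v $ 1) + axis 2 (v $ 2) = v" for r t
    by simp_all
  ultimately show "((\<lambda>x. vector [a x, b x] :: 'a^2) has_vector_derivative v) (at x)"
    by simp
qed

lemma has_vector_derivative_exp:
  fixes f :: "real \<Rightarrow> complex"
  assumes "(f has_vector_derivative f') (at x)"
  shows "((\<lambda>t. exp (f t)) has_vector_derivative f' * exp (f x)) (at x)"
  using field_vector_diff_chain_at[OF assms DERIV_exp] by (simp add: o_def)

lemma has_vector_derivative_inverse_field: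
  fixes f :: "real \<Rightarrow> complex"
  assumes "(f has_vector_derivative f') (at x)" "f x \<noteq> 0"
  shows "((\<lambda>t. inverse (f t)) has_vector_derivative - f' / (f x)\<^sup>2) (at x)"
  using field_vector_diff_chain_at[OF assms(1) DERIV_inverse[OF assms(2)]]
  by (simp add: o_def power2_eq_square field_simps)

lemma continuous_on_vector_2:
  fixes a b :: "'t::topological_space \<Rightarrow> 'a::{topological_space,zero}"
  assumes "continuous_on S a" "continuous_on S b"
  shows "continuous_on S (\<lambda>x. vector [a x, b x] :: 'a^2)"
proof -
  have "(vector [a x, b x] :: 'a^2) = (\<chi> i. if i = 1 then a x else b x)" for x
    by (simp add: vec_eq_iff forall_2)
  moreover have "continuous_on S (\<lambda>x. (\<chi> i. if i = 1 then a x else b x) :: 'a^2)"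
  proof (rule continuous_on_vec_lambda)
    show "continuous_on S (\<lambda>x. if i = 1 then a x else b x)" for i :: 2
      using assms by (cases "i = 1") auto
  qed
  ultimately show ?thesis by simp
qed

section \<open>The path-ordered exponential\<close>

text \<open>By uniqueness for the matrix equation all fundamental solutions take the same value at
  \<open>x\<close>, so the \<open>THE\<close> of the definition is meaningful once some
  \<open>F\<close> exists.\<close>

lemma path_ordered_exp_unique:
  assumes "is_interval I" "continuous_on I M" "x0 \<in> I"
    and F: "fundamental_solution I M x0 F" and "x \<in> I"
  shows "path_ordered_exp I M x x0 = F x"
  unfolding path_ordered_exp_def
proof (rule the_equality)
  show "\<exists>G. fundamental_solution I M x0 G \<and> G x = F x" using F by blast
  fix A assume "\<exists>G. fundamental_solution I M x0 G \<and> G x = A"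
  then obtain G where G: "fundamental_solution I M x0 G" "G x = A" by blast
  have "G x = F x"
    using F G(1) unfolding fundamental_solution_def
    by - (rule linear_ode_unique[OF bounded_bilinear_matrix_matrix_mult assms(1-3) _ _ _ \<open>x \<in> I\<close>],
        simp_all)
  with G(2) show "A = F x" by simp
qed

lemma fundamental_solution_path_ordered_exp:
  assumes "open I" "is_interval I" "continuous_on I M" "x0 \<in> I"
  shows "fundamental_solution I M x0 (\<lambda>x. path_ordered_exp I M x x0)"
proof -
  \<comment> \<open>The series started at the identity matrix supplies a fundamental
    solution.\<close>
  obtain F where F: "fundamental_solution I M x0 F"
    using linear_ode_exists[OF bounded_bilinear_matrix_matrix_mult assms, of "mat 1"]
    unfolding fundamental_solution_def by metis
  \<comment> \<open>Equality with \<open>F\<close> is known on \<open>I\<close>; openness of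
    \<open>I\<close> lets it carry derivatives over.\<close>
  note eq = path_ordered_exp_unique[OF assms(2-4) F]
  show ?thesis
    unfolding fundamental_solution_def
  proof (intro conjI ballI)
    fix x assume x: "x \<in> I"
    show "((\<lambda>x. path_ordered_exp I M x x0) has_vector_derivative
        M x ** path_ordered_exp I M x x0) (at x)"
      unfolding eq[OF x]
      by (rule has_vector_derivative_transform_within_open[OF _ \<open>open I\<close> x])
        (use F x eq in \<open>auto simp: fundamental_solution_def\<close>)
  qed (use F eq \<open>x0 \<in> I\<close> in \<open>simp add: fundamental_solution_def\<close>)
qed

lemma fundamental_solution_iff_path_ordered_exp:
  assumes "open I" "is_interval I" "continuous_on I M" "x0 \<in> I"
  shows "fundamental_solution I M x0 F \<longleftrightarrow> (\<forall>x\<in>I. F x = path_ordered_exp I M x x0)"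
proof
  assume "fundamental_solution I M x0 F"
  from path_ordered_exp_unique[OF assms(2-4) this]
  show "\<forall>x\<in>I. F x = path_ordered_exp I M x x0" by simp
next
  assume eq: "\<forall>x\<in>I. F x = path_ordered_exp I M x x0"
  note E = fundamental_solution_path_ordered_exp[OF assms, unfolded fundamental_solution_def]
  show "fundamental_solution I M x0 F"
    unfolding fundamental_solution_def
  proof (intro conjI ballI)
    fix x assume x: "x \<in> I"
    have "((\<lambda>x. path_ordered_exp I M x x0) has_vector_derivative M x ** F x) (at x)"
      using E x eq by simp
    then show "(F has_vector_derivative M x ** F x) (at x)"
      by (rule has_vector_derivative_transform_within_open[OF _ \<open>open I\<close> x]) (simp add: eq)
  qed (use E eq \<open>x0 \<in> I\<close> in simp)
qed

text \<open>The matrix equation is applied to a constant vector; associativity moves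
  \<open>M x\<close> to the front.\<close>

lemma linear_system_solution_path_ordered_exp:
  assumes "open I" "is_interval I" "continuous_on I M" "x0 \<in> I"
  shows "linear_system_solution I M (\<lambda>x. path_ordered_exp I M x x0 *v v)"
  unfolding linear_system_solution_def
proof
  fix x assume "x \<in> I"
  then have "((\<lambda>x. path_ordered_exp I M x x0) has_vector_derivative
      M x ** path_ordered_exp I M x x0) (at x)"
    using fundamental_solution_path_ordered_exp[OF assms] by (simp add: fundamental_solution_def)
  from bounded_linear.has_vector_derivative[OF bounded_bilinear.bounded_linear_left[OF
      bounded_bilinear_matrix_vector_mult] this]
  show "((\<lambda>x. path_ordered_exp I M x x0 *v v) has_vector_derivative
      M x *v (path_ordered_exp I M x x0 *v v)) (at x)"
    by (simp add: matrix_vector_mul_assoc)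
qed

text \<open>Both sides solve the same initial value problem, since the exponential is the identity
  at \<open>x0\<close>. It thus propagates data from \<open>x0\<close> to \<open>x\<close>.\<close>

lemma linear_system_solution_eq_path_ordered_exp:
  assumes "open I" "is_interval I" "continuous_on I M" "x0 \<in> I"
    and "linear_system_solution I M y" "x \<in> I"
  shows "y x = path_ordered_exp I M x x0 *v y x0"
proof (rule linear_ode_unique[OF bounded_bilinear_matrix_vector_mult assms(2-4) _ _ _ \<open>x \<in> I\<close>])
  show "(y has_vector_derivative M x *v y x) (at x)" if "x \<in> I" for x
    using assms(5) that by (simp add: linear_system_solution_def)
  show "((\<lambda>x. path_ordered_exp I M x x0 *v y x0) has_vector_derivative
      M x *v (path_ordered_exp I M x x0 *v y x0)) (at x)" if "x \<in> I" for x
    using linear_system_solution_path_ordered_exp[OF assms(1-4)] that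
    by (simp add: linear_system_solution_def)
  show "y x0 = path_ordered_exp I M x0 x0 *v y x0"
    using fundamental_solution_path_ordered_exp[OF assms(1-4)]
    by (simp add: fundamental_solution_def)
qed

section \<open>The linear system and the Schroedinger equation\<close>

locale wave_data =
  fixes I :: "real set" and k2 :: "real \<Rightarrow> real" and \<phi> \<Delta> chi s :: "real \<Rightarrow> complex"
  assumes open_I: "open I" and interval_I: "is_interval I"
    and cont_k2: "continuous_on I k2"
    and \<phi>_C2: "\<phi> C2_differentiable_on I"
    and \<Delta>_C1: "\<Delta> C1_differentiable_on I"
    and chi_C1: "chi C1_differentiable_on I"
    and \<phi>'_nonzero: "\<And>x. x \<in> I \<Longrightarrow> vderiv \<phi> x \<noteq> 0"
    and s_C1: "s C1_differentiable_on I"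
    and s_square: "\<And>x. x \<in> I \<Longrightarrow> (s x)^2 = vderiv \<phi> x"
begin

abbreviation "M \<equiv> system_matrix k2 \<phi> \<Delta> chi"
abbreviation "r1 \<equiv> rho1 \<phi> chi"
abbreviation "r2 \<equiv> rho2 k2 \<phi> chi"

lemma deriv:
  assumes "x \<in> I"
  shows "(\<phi> has_vector_derivative vderiv \<phi> x) (at x)"
    and "(vderiv \<phi> has_vector_derivative vderiv (vderiv \<phi>) x) (at x)"
    and "(\<Delta> has_vector_derivative vderiv \<Delta> x) (at x)"
    and "(chi has_vector_derivative vderiv chi x) (at x)"
    and "(s has_vector_derivative vderiv s x) (at x)"
  using assms \<phi>_C2 \<Delta>_C1 chi_C1 s_C1
  by (auto simp: C2_differentiable_on_def C1_differentiable_on_eq vector_derivative_works[symmetric])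

lemma s_nonzero: "x \<in> I \<Longrightarrow> s x \<noteq> 0"
  using s_square \<phi>'_nonzero by fastforce

text \<open>Differentiation of \<open>s\<^sup>2 = \<phi>'\<close>, which holds near \<open>x\<close>
  because \<open>I\<close> is open. It turns \<open>s' / s\<close> into
  \<open>\<phi>'' / (2 \<phi>')\<close>.\<close>

lemma s_deriv_eq:
  assumes "x \<in> I"
  shows "vderiv (vderiv \<phi>) x = 2 * s x * vderiv s x"
proof -
  have "((\<lambda>t. s t * s t) has_vector_derivative s x * vderiv s x + vderiv s x * s x) (at x)"
    by (intro has_vector_derivative_mult deriv assms)
  then have "(vderiv \<phi> has_vector_derivative s x * vderiv s x + vderiv s x * s x) (at x)"
    by (rule has_vector_derivative_transform_within_open[OF _ open_I assms])
      (simp add: s_square[symmetric] power2_eq_square)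
  from vector_derivative_unique_at[OF deriv(2)[OF assms] this] show ?thesis by simp
qed

text \<open>This makes the theory of linear equations applicable to the system.\<close>

lemma continuous_M: "continuous_on I M"
proof -
  have "continuous_on I f" if "f C1_differentiable_on I" for f :: "real \<Rightarrow> complex"
    using that by (simp add: C1_diff_imp_diff differentiable_imp_continuous_on)
  then have c: "continuous_on I \<phi>" "continuous_on I \<Delta>" "continuous_on I chi" "continuous_on I k2"
    "continuous_on I (vderiv \<phi>)" "continuous_on I (vderiv (vderiv \<phi>))"
    "continuous_on I (vderiv \<Delta>)" "continuous_on I (vderiv chi)"
    using \<phi>_C2 \<Delta>_C1 chi_C1 cont_k2
    by (simp_all add: C2_differentiable_on_def) (simp_all add: C1_differentiable_on_eq)
  show ?thesis
    unfolding system_matrix_def Let_def rho1_def rho2_def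
    by (intro continuous_on_vector_2 continuous_intros c) (use \<phi>'_nonzero in auto)
qed

section \<open>From the coefficients a, b to the amplitudes p, q\<close>

abbreviation ph :: "complex \<Rightarrow> real \<Rightarrow> complex"
  where "ph j x \<equiv> exp (j * (\<phi> x + \<Delta> x))"

text \<open>The two rows of the system are exchanged by swapping the unknowns and replacing \<open>\<i>\<close> by
  \<open>- \<i>\<close>; the parameter \<open>j\<close> stands for either square root of \<open>-1\<close>.\<close>

definition coupled :: "complex \<Rightarrow> (real \<Rightarrow> complex) \<Rightarrow> (real \<Rightarrow> complex) \<Rightarrow> real \<Rightarrow> bool"
  where "coupled j a b x \<longleftrightarrow> (a has_vector_derivative
    (j * (r2 x - 2 * vderiv \<phi> x * vderiv \<Delta> x) * a x
      + (r1 x + j * r2 x) * (ph (- j) x * ph (- j) x) * b x) / (2 * vderiv \<phi> x)) (at x)"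

text \<open>The form that \<open>coupled j a b\<close> takes for \<open>p = a * ph j / s\<close> and
  \<open>q = b * ph (- j) / s\<close>: the exponentials and \<open>\<Delta>\<close> disappear, and
  the derivative of \<open>1 / s\<close> leaves the term with \<open>\<phi>''\<close>.\<close>

definition amplitude :: "complex \<Rightarrow> (real \<Rightarrow> complex) \<Rightarrow> (real \<Rightarrow> complex) \<Rightarrow> real \<Rightarrow> bool"
  where "amplitude j p q x \<longleftrightarrow> (p has_vector_derivative
    (j * r2 x * p x + (r1 x + j * r2 x) * q x - vderiv (vderiv \<phi>) x * p x) / (2 * vderiv \<phi> x)
      + j * vderiv \<phi> x * p x) (at x)"

lemma linear_system_iff_coupled:
  "linear_system_solution I M (\<lambda>x. vector [a x, b x]) \<longleftrightarrow>
    (\<forall>x\<in>I. coupled \<i> a b x \<and> coupled (- \<i>) b a x)"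
proof -
  have "(M x *v vector [a x, b x]) $ 1 = (\<i> * (r2 x - 2 * vderiv \<phi> x * vderiv \<Delta> x) * a x
      + (r1 x + \<i> * r2 x) * (ph (- \<i>) x * ph (- \<i>) x) * b x) / (2 * vderiv \<phi> x)" (is ?e1)
    and "(M x *v vector [a x, b x]) $ 2 = (- \<i> * (r2 x - 2 * vderiv \<phi> x * vderiv \<Delta> x) * b x
      + (r1 x + - \<i> * r2 x) * (ph (- (- \<i>)) x * ph (- (- \<i>)) x) * a x) / (2 * vderiv \<phi> x)" (is ?e2)
    if x: "x \<in> I" for x
  proof -
    \<comment> \<open>Written as products of \<open>ph\<close>, the exponentials can later cancel by
      \<open>ph_mult\<close>; named \<open>N\<close> and \<open>P\<close>, they are atoms for the
      field arithmetic.\<close>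
    define N P where "N = ph (- \<i>) x * ph (- \<i>) x" and "P = ph \<i> x * ph \<i> x"
    have N: "exp (- 2 * \<i> * \<phi> x - 2 * \<i> * \<Delta> x) = N"
      unfolding N_def exp_add[symmetric] by (rule arg_cong[of _ _ exp]) (simp add: algebra_simps)
    have P: "exp (2 * \<i> * \<phi> x + 2 * \<i> * \<Delta> x) = P"
      unfolding P_def exp_add[symmetric] by (rule arg_cong[of _ _ exp]) (simp add: algebra_simps)
    note entries = system_matrix_def Let_def matrix_vector_mult_def sum_2 vec_lambda_beta vector_2
    show ?e1
      unfolding N_def[symmetric] entries N P using \<phi>'_nonzero[OF x] by (simp add: field_simps)
    show ?e2
      unfolding minus_minus P_def[symmetric] entries N P
      using \<phi>'_nonzero[OF x] by (simp add: field_simps)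
  qed
  then show ?thesis
    unfolding linear_system_solution_def has_vector_derivative_vector_2 coupled_def
    by (simp only: cong: ball_cong)
qed

lemma ph_mult: "ph j x * ph (- j) x = 1" "ph (- j) x * ph j x = 1"
  by (simp_all add: exp_add[symmetric])

lemma ph_deriv:
  assumes "x \<in> I"
  shows "(ph j has_vector_derivative j * (vderiv \<phi> x + vderiv \<Delta> x) * ph j x) (at x)"
  by (intro has_vector_derivative_exp has_vector_derivative_mult_right
      has_vector_derivative_add deriv assms)

text \<open>In the product rule the phase contributes \<open>j (\<phi>' + \<Delta>') p\<close> and
  the factor \<open>1 / s\<close> contributes \<open>- (s' / s) p\<close>.\<close>

lemma coupled_imp_amplitude:
  assumes x: "x \<in> I" and ab: "coupled j a b x"
  shows "amplitude j (\<lambda>t. a t * (ph j t / s t)) (\<lambda>t. b t * (ph (- j) t / s t)) x"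
proof -
  have nz: "s x \<noteq> 0" using x by (rule s_nonzero)
  define p q where "p = a x * (ph j x / s x)" and "q = b x * (ph (- j) x / s x)"
  note dp = has_vector_derivative_mult[OF ab[unfolded coupled_def]
      has_vector_derivative_mult[OF ph_deriv[OF x]
        has_vector_derivative_inverse_field[OF deriv(5)[OF x] nz]], folded divide_inverse]
  have "a x * (ph j x * (- vderiv s x / (s x)\<^sup>2) + j * (vderiv \<phi> x + vderiv \<Delta> x) * ph j x / s x) =
      (j * (vderiv \<phi> x + vderiv \<Delta> x) - vderiv s x / s x) * p"
    using nz by (simp add: p_def field_simps power2_eq_square)
  \<comment> \<open>The square of \<open>ph (- j)\<close> times \<open>ph j\<close> leaves one
    \<open>ph (- j)\<close>, so the coupling to \<open>b\<close> becomes a coupling to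
    \<open>q\<close>.\<close>
  moreover have "(j * (r2 x - 2 * vderiv \<phi> x * vderiv \<Delta> x) * a x
        + (r1 x + j * r2 x) * (ph (- j) x * ph (- j) x) * b x) / (2 * vderiv \<phi> x) * (ph j x / s x) =
      (j * (r2 x - 2 * vderiv \<phi> x * vderiv \<Delta> x) * p + (r1 x + j * r2 x) * q) / (2 * vderiv \<phi> x)"
  proof -
    have "(r1 x + j * r2 x) * (ph (- j) x * ph (- j) x) * b x * (ph j x / s x) =
        (r1 x + j * r2 x) * q * (ph j x * ph (- j) x)"
      unfolding q_def by (simp only: mult_ac times_divide_eq_left times_divide_eq_right)
    moreover have "(u + v) / w * z = (u * z + v * z) / w" for u v w z :: complex
      by (simp add: distrib_right)
    ultimately show ?thesis
      unfolding ph_mult p_def by (simp only: mult_1_right mult.assoc)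
  qed
  \<comment> \<open>The term \<open>j \<Delta>' p\<close> from the phase cancels
    \<open>- j \<Delta>' p\<close> from the system.\<close>
  moreover have "(j * (vderiv \<phi> x + vderiv \<Delta> x) - vderiv s x / s x) * p
      + (j * (r2 x - 2 * vderiv \<phi> x * vderiv \<Delta> x) * p + (r1 x + j * r2 x) * q) / (2 * vderiv \<phi> x)
    = (j * r2 x * p + (r1 x + j * r2 x) * q - vderiv (vderiv \<phi>) x * p) / (2 * vderiv \<phi> x)
      + j * vderiv \<phi> x * p"
    using nz by (simp add: s_deriv_eq[OF x] s_square[OF x, symmetric] field_simps power2_eq_square)
  ultimately show ?thesis
    unfolding amplitude_def p_def[symmetric] q_def[symmetric]
    by (intro has_vector_derivative_eq_rhs[OF dp]) (simp only:)
qed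

text \<open>The substitution is undone by multiplying with \<open>s * ph (- j)\<close>, as
  \<open>ph (- j)\<close> is inverse to \<open>ph j\<close>. The derivative of \<open>s\<close> now
  removes \<open>\<phi>''\<close>, and that of the phase brings \<open>\<Delta>'\<close>
  back.\<close>

lemma amplitude_imp_coupled:
  assumes x: "x \<in> I" and pq: "amplitude j p q x"
  shows "coupled j (\<lambda>t. p t * (s t * ph (- j) t)) (\<lambda>t. q t * (s t * ph j t)) x"
proof -
  have nz: "s x \<noteq> 0" using x by (rule s_nonzero)
  \<comment> \<open>With this name the field identity below treats the exponential as an atom; the
    relation \<open>ph j x * g = 1\<close> is used separately.\<close>
  define g where "g = ph (- j) x"
  note dp = has_vector_derivative_mult[OF pq[unfolded amplitude_def]
      has_vector_derivative_mult[OF deriv(5)[OF x] ph_deriv[OF x, of "- j"]], folded g_def]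
  have g: "ph j x * g = 1" unfolding g_def by (rule ph_mult)
  have "(r1 x + j * r2 x) * (g * g) * (q x * (s x * ph j x)) =
      (r1 x + j * r2 x) * (g * (q x * s x)) * (ph j x * g)"
    by (simp only: mult_ac)
  then have *: "(r1 x + j * r2 x) * (g * g) * (q x * (s x * ph j x)) =
      (r1 x + j * r2 x) * (g * (q x * s x))"
    by (simp only: g mult_1_right)
  have "p x * (s x * (- j * (vderiv \<phi> x + vderiv \<Delta> x) * g) + vderiv s x * g)
      + ((j * r2 x * p x + (r1 x + j * r2 x) * q x - vderiv (vderiv \<phi>) x * p x) / (2 * vderiv \<phi> x)
        + j * vderiv \<phi> x * p x) * (s x * g)
    = (j * (r2 x - 2 * vderiv \<phi> x * vderiv \<Delta> x) * (p x * (s x * g))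
        + (r1 x + j * r2 x) * (g * (q x * s x))) / (2 * vderiv \<phi> x)"
    using nz by (simp add: s_deriv_eq[OF x] s_square[OF x, symmetric] field_simps power2_eq_square)
  then show ?thesis
    unfolding coupled_def g_def[symmetric]
    by (intro has_vector_derivative_eq_rhs[OF dp]) (simp only: *)
qed

section \<open>The Schroedinger equation in terms of the amplitudes\<close>

lemma psi_of_eq: "psi_of s \<phi> \<Delta> a b x = a x * (ph \<i> x / s x) + b x * (ph (- \<i>) x / s x)"
proof -
  have "exp (- \<i> * \<phi> x - \<i> * \<Delta> x) = ph (- \<i>) x"
    by (rule arg_cong[of _ _ exp]) (simp add: algebra_simps)
  then show ?thesis by (simp only: psi_of_def distrib_left)
qed

text \<open>In the sum of the two equations the \<open>r2\<close> terms cancel, and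
  \<open>r1 - \<phi>'' = 2 chi \<phi>'\<close> produces the term
  \<open>chi * (p + q)\<close>.\<close>

lemma amplitude_imp_sum_deriv:
  assumes x: "x \<in> I" and p: "amplitude \<i> p q x" and q: "amplitude (- \<i>) q p x"
  shows "((\<lambda>t. p t + q t) has_vector_derivative
      chi x * (p x + q x) + \<i> * vderiv \<phi> x * (p x - q x)) (at x)"
  using \<phi>'_nonzero[OF x]
  by (intro has_vector_derivative_eq_rhs[OF has_vector_derivative_add[OF p[unfolded amplitude_def]
        q[unfolded amplitude_def]]])
    (simp add: rho1_def field_simps)

text \<open>When \<open>chi \<psi> + \<i> \<phi>' (p - q)\<close> is differentiated again, the terms
  in \<open>p - q\<close> cancel because \<open>r1 + \<phi>'' = 2 (\<phi>'' + chi \<phi>')\<close>,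
  and the definition of \<open>r2\<close> leaves \<open>- k2 \<psi>\<close>.\<close>

lemma amplitude_imp_schrodinger:
  assumes pq: "\<And>x. x \<in> I \<Longrightarrow> amplitude \<i> p q x \<and> amplitude (- \<i>) q p x"
    and \<psi>: "\<And>x. x \<in> I \<Longrightarrow> \<psi> x = p x + q x"
  shows "schrodinger_solution I k2 \<psi>"
  unfolding schrodinger_solution_def
proof (intro ballI conjI)
  \<comment> \<open>\<open>D\<close> is an explicit formula for the first derivative on
    \<open>I\<close>; differentiating it gives the second derivative, again by openness of
    \<open>I\<close>.\<close>
  define D where "D x = chi x * (p x + q x) + \<i> * vderiv \<phi> x * (p x - q x)" for x
  have \<psi>': "(\<psi> has_vector_derivative D x) (at x)" if "x \<in> I" for x
    unfolding D_def
    by (rule has_vector_derivative_transform_within_open[OF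
          amplitude_imp_sum_deriv[OF that conjunct1[OF pq[OF that]] conjunct2[OF pq[OF that]]] open_I that])
      (simp add: \<psi>)
  fix x assume x: "x \<in> I"
  note d = deriv[OF x]
  note p' = conjunct1[OF pq[OF x], unfolded amplitude_def]
  note q' = conjunct2[OF pq[OF x], unfolded amplitude_def]
  have "(D has_vector_derivative - of_real (k2 x) * \<psi> x) (at x)"
    unfolding D_def
    by (rule has_vector_derivative_eq_rhs[OF has_vector_derivative_add[OF
          has_vector_derivative_mult[OF d(4)
            amplitude_imp_sum_deriv[OF x conjunct1[OF pq[OF x]] conjunct2[OF pq[OF x]]]]
          has_vector_derivative_mult[OF has_vector_derivative_mult_right[OF d(2)]
            has_vector_derivative_diff[OF p' q']]]])
      (use \<phi>'_nonzero[OF x] in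
        \<open>simp add: \<psi>[OF x] rho1_def rho2_def field_simps power2_eq_square\<close>)
  then have *: "(vderiv \<psi> has_vector_derivative - of_real (k2 x) * \<psi> x) (at x)"
    by (rule has_vector_derivative_transform_within_open[OF _ open_I x])
      (simp add: vector_derivative_at[OF \<psi>'])
  show "\<psi> differentiable at x" using \<psi>'[OF x] by (rule differentiableI_vector)
  show "vderiv \<psi> differentiable at x" using * by (rule differentiableI_vector)
  show "vderiv (vderiv \<psi>) x + of_real (k2 x) * \<psi> x = 0"
    by (simp add: vector_derivative_at[OF *])
qed

lemma schrodinger_imp_amplitude:
  assumes \<psi>: "schrodinger_solution I k2 \<psi>"
  shows "\<exists>p q. (\<forall>x\<in>I. amplitude \<i> p q x \<and> amplitude (- \<i>) q p x) \<and> (\<forall>x. \<psi> x = p x + q x)"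
proof -
  \<comment> \<open>The relation \<open>\<psi>' = chi \<psi> + \<i> \<phi>' (p - q)\<close> solved
    for \<open>w = p - q\<close>; together with \<open>p + q = \<psi>\<close> it determines
    \<open>p\<close> and \<open>q\<close>.\<close>
  define w where "w x = - \<i> * (vderiv \<psi> x - chi x * \<psi> x) * inverse (vderiv \<phi> x)" for x
  define p q where "p x = (\<psi> x + w x) / 2" and "q x = (\<psi> x - w x) / 2" for x
  have "\<psi> x = p x + q x" for x by (simp add: p_def q_def field_simps)
  moreover have "amplitude \<i> p q x \<and> amplitude (- \<i>) q p x" if x: "x \<in> I" for x
  proof -
    note nz = \<phi>'_nonzero[OF x] and d = deriv[OF x]
    have d1: "(\<psi> has_vector_derivative vderiv \<psi> x) (at x)"
      and d2: "(vderiv \<psi> has_vector_derivative - of_real (k2 x) * \<psi> x) (at x)"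
      using \<psi> x unfolding schrodinger_solution_def
      by (auto simp: vector_derivative_works eq_neg_iff_add_eq_0[symmetric])
    have \<psi>': "vderiv \<psi> x = chi x * \<psi> x + \<i> * vderiv \<phi> x * w x"
      using nz by (simp add: w_def field_simps)
    \<comment> \<open>Here the Schroedinger equation replaces the second derivative of
      \<open>\<psi>\<close>, and the first derivative is eliminated in favour of
      \<open>\<psi>\<close> and \<open>w\<close>.\<close>
    have w': "(w has_vector_derivative
        \<i> * (of_real (k2 x) + vderiv chi x + (chi x)\<^sup>2) * \<psi> x / vderiv \<phi> x - chi x * w x
          - w x * vderiv (vderiv \<phi>) x / vderiv \<phi> x) (at x)"
    proof -
      have w: "- \<i> * (vderiv \<psi> x - chi x * \<psi> x) = w x * vderiv \<phi> x"
        using nz by (simp add: w_def field_simps)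
      have "((\<lambda>t. - \<i> * (vderiv \<psi> t - chi t * \<psi> t) * inverse (vderiv \<phi> t)) has_vector_derivative
          - \<i> * (vderiv \<psi> x - chi x * \<psi> x) * (- vderiv (vderiv \<phi>) x / (vderiv \<phi> x)\<^sup>2)
          + - \<i> * (- of_real (k2 x) * \<psi> x - (chi x * vderiv \<psi> x + vderiv chi x * \<psi> x))
            * inverse (vderiv \<phi> x)) (at x)"
        by (intro has_vector_derivative_mult has_vector_derivative_diff has_vector_derivative_mult_right
            has_vector_derivative_inverse_field d1 d2 d nz)
      then show ?thesis
        unfolding w w_def[symmetric]
        by (rule has_vector_derivative_eq_rhs)
          (use nz in \<open>simp add: \<psi>' field_simps power2_eq_square\<close>)
    qed
    show ?thesis
      unfolding amplitude_def
    proof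
      show "(p has_vector_derivative
        (\<i> * r2 x * p x + (r1 x + \<i> * r2 x) * q x - vderiv (vderiv \<phi>) x * p x) / (2 * vderiv \<phi> x)
          + \<i> * vderiv \<phi> x * p x) (at x)"
        unfolding p_def
        by (rule has_vector_derivative_eq_rhs[OF has_vector_derivative_divide[OF
              has_vector_derivative_add[OF d1 w']]], unfold \<psi>')
          (use nz in \<open>simp add: p_def q_def rho1_def rho2_def field_simps power2_eq_square\<close>)
      show "(q has_vector_derivative
        (- \<i> * r2 x * q x + (r1 x + - \<i> * r2 x) * p x - vderiv (vderiv \<phi>) x * q x) / (2 * vderiv \<phi> x)
          + - \<i> * vderiv \<phi> x * q x) (at x)"
        unfolding q_def
        by (rule has_vector_derivative_eq_rhs[OF has_vector_derivative_divide[OF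
              has_vector_derivative_diff[OF d1 w']]], unfold \<psi>')
          (use nz in \<open>simp add: p_def q_def rho1_def rho2_def field_simps power2_eq_square\<close>)
    qed
  qed
  ultimately show ?thesis by blast
qed

section \<open>Translation to the linear system and the gauge condition\<close>

lemma linear_system_imp_amplitude:
  assumes "linear_system_solution I M (\<lambda>x. vector [a x, b x])" "x \<in> I"
  shows "amplitude \<i> (\<lambda>t. a t * (ph \<i> t / s t)) (\<lambda>t. b t * (ph (- \<i>) t / s t)) x \<and>
    amplitude (- \<i>) (\<lambda>t. b t * (ph (- \<i>) t / s t)) (\<lambda>t. a t * (ph \<i> t / s t)) x"
  using coupled_imp_amplitude[OF assms(2), of \<i> a b] coupled_imp_amplitude[OF assms(2), of "- \<i>" b a]
    assms unfolding linear_system_iff_coupled minus_minus by blast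

lemma linear_system_imp_schrodinger:
  assumes "linear_system_solution I M (\<lambda>x. vector [a x, b x])"
    and "\<And>x. x \<in> I \<Longrightarrow> \<psi> x = psi_of s \<phi> \<Delta> a b x"
  shows "schrodinger_solution I k2 \<psi>"
  by (rule amplitude_imp_schrodinger[OF linear_system_imp_amplitude[OF assms(1)]])
    (simp_all only: assms(2) psi_of_eq)

text \<open>The functions differentiated in the gauge condition are \<open>p * e (- \<i>)\<close>
  and \<open>q * e \<i>\<close>, so its left-hand side is
  \<open>p' + q' - \<i> \<phi>' (p - q)\<close>, which the formula for the derivative of
  \<open>p + q\<close> reduces to \<open>chi \<psi>\<close>.\<close>

lemma linear_system_imp_gauge_condition:
  assumes ab: "linear_system_solution I M (\<lambda>x. vector [a x, b x])"
  shows "gauge_condition I s \<phi> \<Delta> chi a b"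
  unfolding gauge_condition_def
proof
  define p q where "p t = a t * (ph \<i> t / s t)" and "q t = b t * (ph (- \<i>) t / s t)" for t
  define e where "e j t = exp (j * \<phi> t)" for j t
  have ee: "e \<i> t * e (- \<i>) t = 1" for t by (simp add: e_def exp_add[symmetric])
  have pe: "a t * exp (\<i> * \<Delta> t) / s t = p t * e (- \<i>) t" for t
    by (simp add: p_def e_def exp_add[symmetric] algebra_simps)
  have qe: "b t * exp (- \<i> * \<Delta> t) / s t = q t * e \<i> t" for t
    by (simp add: q_def e_def exp_add[symmetric] algebra_simps)
  fix x assume x: "x \<in> I"
  note pq = linear_system_imp_amplitude[OF ab x, folded p_def q_def]
  have e': "(e j has_vector_derivative j * vderiv \<phi> x * e j x) (at x)" for j
    unfolding e_def by (intro has_vector_derivative_exp has_vector_derivative_mult_right deriv x)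
  obtain p' q' where d: "(p has_vector_derivative p') (at x)" "(q has_vector_derivative q') (at x)"
    using pq unfolding amplitude_def by blast
  \<comment> \<open>Uniqueness of derivatives gives the sum without expanding \<open>p'\<close> and
    \<open>q'\<close>.\<close>
  have sum: "p' + q' = chi x * (p x + q x) + \<i> * vderiv \<phi> x * (p x - q x)"
    by (rule vector_derivative_unique_at[OF has_vector_derivative_add[OF d]
        amplitude_imp_sum_deriv[OF x conjunct1[OF pq] conjunct2[OF pq]]])
  note P = has_vector_derivative_mult[OF d(1) e'[of "- \<i>"]]
    and Q = has_vector_derivative_mult[OF d(2) e'[of \<i>]]
  have "(p x * (- \<i> * vderiv \<phi> x * e (- \<i>) x) + p' * e (- \<i>) x) * e \<i> x
      + (q x * (\<i> * vderiv \<phi> x * e \<i> x) + q' * e \<i> x) * e (- \<i>) x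
    = (p' + q' - \<i> * vderiv \<phi> x * (p x - q x)) * (e \<i> x * e (- \<i>) x)"
    by (simp add: algebra_simps)
  also have "\<dots> = chi x * psi_of s \<phi> \<Delta> a b x"
    unfolding ee sum psi_of_eq p_def q_def by simp
  finally show "(\<lambda>t. a t * exp (\<i> * \<Delta> t) / s t) differentiable at x \<and>
      (\<lambda>t. b t * exp (- \<i> * \<Delta> t) / s t) differentiable at x \<and>
      vderiv (\<lambda>t. a t * exp (\<i> * \<Delta> t) / s t) x * exp (\<i> * \<phi> x)
        + vderiv (\<lambda>t. b t * exp (- \<i> * \<Delta> t) / s t) x * exp (- \<i> * \<phi> x)
      = chi x * psi_of s \<phi> \<Delta> a b x"
    unfolding pe qe e_def[symmetric] vector_derivative_at[OF P] vector_derivative_at[OF Q]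
    using differentiableI_vector[OF P] differentiableI_vector[OF Q] by blast
qed

lemma schrodinger_imp_linear_system:
  assumes "schrodinger_solution I k2 \<psi>"
  shows "\<exists>a b. linear_system_solution I M (\<lambda>x. vector [a x, b x]) \<and>
    (\<forall>x\<in>I. \<psi> x = psi_of s \<phi> \<Delta> a b x)"
proof -
  obtain p q where pq: "\<And>x. x \<in> I \<Longrightarrow> amplitude \<i> p q x \<and> amplitude (- \<i>) q p x"
    and \<psi>: "\<And>x. \<psi> x = p x + q x"
    using schrodinger_imp_amplitude[OF assms] by metis
  \<comment> \<open>The inverse of the substitution that leads from \<open>a\<close>,
    \<open>b\<close> to \<open>p\<close>, \<open>q\<close>.\<close>
  define a b where "a t = p t * (s t * ph (- \<i>) t)" and "b t = q t * (s t * ph \<i> t)" for t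
  have "linear_system_solution I M (\<lambda>x. vector [a x, b x])"
    unfolding linear_system_iff_coupled a_def b_def
    using amplitude_imp_coupled[of _ \<i> p q] amplitude_imp_coupled[of _ "- \<i>" q p] pq
    unfolding minus_minus by blast
  moreover have "\<psi> x = psi_of s \<phi> \<Delta> a b x" if "x \<in> I" for x
  proof -
    have "psi_of s \<phi> \<Delta> a b x =
        p x * (s x * (ph \<i> x * ph (- \<i>) x)) / s x + q x * (s x * (ph \<i> x * ph (- \<i>) x)) / s x"
      unfolding psi_of_eq a_def b_def by (simp only: mult_ac times_divide_eq_right)
    also have "\<dots> = \<psi> x"
      unfolding ph_mult using s_nonzero[OF that] by (simp add: \<psi>)
    finally show ?thesis by simp
  qed
  ultimately show ?thesis by blast
qed

text \<open>At \<open>x\<close> the function \<open>psi_of\<close> sees \<open>a\<close> and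
  \<open>b\<close> only through their values there, so constant functions can carry the entries of
  \<open>v\<close>.\<close>

lemma psi_of_eq_wave_row:
  "1 / s x * (\<Sum>i\<in>UNIV. wave_row \<phi> \<Delta> x $ i * v $ i) = psi_of s \<phi> \<Delta> (\<lambda>_. v $ 1) (\<lambda>_. v $ 2) x"
  by (simp add: wave_row_def psi_of_def sum_2 add_divide_distrib mult_ac)

end

theorem mainTheorem1:
  fixes I :: "real set" and k2 :: "real \<Rightarrow> real"
    and \<phi> \<Delta> chi s :: "real \<Rightarrow> complex"
  assumes "open I" and "is_interval I"
    and "continuous_on I k2"
    and "\<phi> C2_differentiable_on I"
    and "\<Delta> C1_differentiable_on I"
    and "chi C1_differentiable_on I"
    and "\<And>x. x \<in> I \<Longrightarrow> vderiv \<phi> x \<noteq> 0"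
    and "s C1_differentiable_on I"
    and "\<And>x. x \<in> I \<Longrightarrow> (s x)^2 = vderiv \<phi> x"
  shows
    "(\<forall>a b. linear_system_solution I (system_matrix k2 \<phi> \<Delta> chi) (\<lambda>x. vector [a x, b x]) \<longrightarrow>
        gauge_condition I s \<phi> \<Delta> chi a b \<and>
        schrodinger_solution I k2 (psi_of s \<phi> \<Delta> a b))
     \<and> (\<forall>\<psi>. schrodinger_solution I k2 \<psi> \<longrightarrow>
        (\<exists>a b. linear_system_solution I (system_matrix k2 \<phi> \<Delta> chi) (\<lambda>x. vector [a x, b x]) \<and>
          (\<forall>x\<in>I. \<psi> x = psi_of s \<phi> \<Delta> a b x)))
     \<and> (\<forall>x0\<in>I.
        (\<forall>F. fundamental_solution I (system_matrix k2 \<phi> \<Delta> chi) x0 F \<longleftrightarrow>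
          (\<forall>x\<in>I. F x = path_ordered_exp I (system_matrix k2 \<phi> \<Delta> chi) x x0))
        \<and> (\<forall>a b. linear_system_solution I (system_matrix k2 \<phi> \<Delta> chi) (\<lambda>x. vector [a x, b x]) \<longrightarrow>
          (\<forall>x\<in>I. psi_of s \<phi> \<Delta> a b x = 1 / s x *
            (\<Sum>i\<in>UNIV. wave_row \<phi> \<Delta> x $ i *
              (path_ordered_exp I (system_matrix k2 \<phi> \<Delta> chi) x x0 *v vector [a x0, b x0]) $ i)))
        \<and> (\<forall>\<psi>. schrodinger_solution I k2 \<psi> \<longleftrightarrow>
          (\<exists>a0 b0. \<forall>x\<in>I. \<psi> x = 1 / s x *
            (\<Sum>i\<in>UNIV. wave_row \<phi> \<Delta> x $ i *
              (path_ordered_exp I (system_matrix k2 \<phi> \<Delta> chi) x x0 *v vector [a0, b0]) $ i))))"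
proof -
  interpret wave_data I k2 \<phi> \<Delta> chi s
    using assms by unfold_locales
  note ode = open_I interval_I continuous_M
  have vec_eta: "vector [v $ 1, v $ 2] = v" for v :: "complex^2"
    by (simp add: vec_eq_iff forall_2)
  \<comment> \<open>The exponential applied to the data at \<open>x0\<close> is the pair
    \<open>(a x, b x)\<close>, which the row vector combines into \<open>psi_of\<close>.\<close>
  have formula: "psi_of s \<phi> \<Delta> a b x = 1 / s x * (\<Sum>i\<in>UNIV. wave_row \<phi> \<Delta> x $ i *
      (path_ordered_exp I M x x0 *v vector [a x0, b x0]) $ i)"
    if "x0 \<in> I" "linear_system_solution I M (\<lambda>x. vector [a x, b x])" "x \<in> I" for x0 a b x
    unfolding psi_of_eq_wave_row linear_system_solution_eq_path_ordered_exp[OF ode that, symmetric]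
    by (simp add: psi_of_def)
  \<comment> \<open>For any initial vector the components of the propagated vector solve the system
    and serve as \<open>a\<close> and \<open>b\<close>.\<close>
  have general: "schrodinger_solution I k2 \<psi>"
    if x0: "x0 \<in> I" and \<psi>: "\<forall>x\<in>I. \<psi> x = 1 / s x * (\<Sum>i\<in>UNIV. wave_row \<phi> \<Delta> x $ i *
      (path_ordered_exp I M x x0 *v vector [a0, b0]) $ i)" for x0 \<psi> a0 b0
  proof -
    let ?y = "\<lambda>x. path_ordered_exp I M x x0 *v vector [a0, b0]"
    show ?thesis
    proof (rule linear_system_imp_schrodinger)
      show "linear_system_solution I M (\<lambda>x. vector [?y x $ 1, ?y x $ 2])"
        unfolding vec_eta by (rule linear_system_solution_path_ordered_exp[OF ode x0])
      show "\<psi> x = psi_of s \<phi> \<Delta> (\<lambda>x. ?y x $ 1) (\<lambda>x. ?y x $ 2) x" if "x \<in> I" for x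
        using \<psi> that unfolding psi_of_eq_wave_row by (simp add: psi_of_def)
    qed
  qed
  show ?thesis
  proof (intro conjI allI impI ballI)
    fix x0 F assume "x0 \<in> I"
    then show "fundamental_solution I M x0 F \<longleftrightarrow> (\<forall>x\<in>I. F x = path_ordered_exp I M x x0)"
      by (rule fundamental_solution_iff_path_ordered_exp[OF ode])
  next
    fix x0 \<psi> assume x0: "x0 \<in> I"
    show "schrodinger_solution I k2 \<psi> \<longleftrightarrow>
        (\<exists>a0 b0. \<forall>x\<in>I. \<psi> x = 1 / s x * (\<Sum>i\<in>UNIV. wave_row \<phi> \<Delta> x $ i *
          (path_ordered_exp I M x x0 *v vector [a0, b0]) $ i))"
    proof
      assume "schrodinger_solution I k2 \<psi>"
      then obtain a b where ab: "linear_system_solution I M (\<lambda>x. vector [a x, b x])"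
        and \<psi>: "\<forall>x\<in>I. \<psi> x = psi_of s \<phi> \<Delta> a b x"
        using schrodinger_imp_linear_system by blast
      \<comment> \<open>The constants are the values of \<open>a\<close> and \<open>b\<close> at
        \<open>x0\<close>.\<close>
      show "\<exists>a0 b0. \<forall>x\<in>I. \<psi> x = 1 / s x * (\<Sum>i\<in>UNIV. wave_row \<phi> \<Delta> x $ i *
          (path_ordered_exp I M x x0 *v vector [a0, b0]) $ i)"
        using formula[OF x0 ab] \<psi> by (intro exI[of _ "a x0"] exI[of _ "b x0"]) simp
    qed (use general[OF x0] in blast)
  qed (simp_all add: linear_system_imp_gauge_condition linear_system_imp_schrodinger
      schrodinger_imp_linear_system formula)
qed

end
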